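(* Let $L$, $M$, $D_a$ be the infinite matrices defined in the context, and for $k\ge 1$ let $M(k)$ be the $k\times k$ submatrix of $M$ with coefficients $m_{i,j}$, $0\le i,j<k$. Then: (i) $$L\,D_a\,M=D_a .$$ (ii) For every $n\ge 0$, $$M(2^{n+2})=\left(\begin{array}{cccc} A'&0&0&0 \\ B'&A'&0&0 \\ A'&B'&A'&0 \\ B'&0&B'&A' \end{array}\right),$$ where $A'$ and $B'$ are the $2^n\times 2^n$ submatrices of $M(2^{n+1})$ given by the block decomposition $M(2^{n+1})=\left(\begin{array}{cc} A'&0 \\ B'&A' \end{array}\right)$.
   Context: All infinite matrices are indexed by integers $i,j\ge 0$ and have integer coefficients (products are taken over $\mathbb{Z}$). $L$ is the infinite unipotent lower triangular matrix with coefficients $l_{i,j}\in\{0,1\}$ given by $l_{i,j}\equiv\binom{2i+1}{i-j}\pmod 2$ (with the binomial coefficient equal to $0$ if $i<j$). $M$ is the infinite unipotent lower triangular matrix with coefficients $m_{i,j}\in\{0,1\}$ given by $m_{i,j}\equiv\binom{i+j}{2j}\pmod 2$. $D_a$ is the infinite diagonal matrix with diagonal entries $1,-1,1,-1,\dots$ (i.e. $(-1)^i$ in position $i$). *)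

theory Defs
  imports "HOL-Library.Groups_Big_Fun" "Jordan_Normal_Form.Matrix"
begin

type_synonym infmat = "nat \<Rightarrow> nat \<Rightarrow> int"

(* Sum_any is 0 when infinitely many summands are nonzero. This never happens when the
   left factor is lower triangular, see finite_support_mult_infmat. *)
definition mult_infmat :: "infmat \<Rightarrow> infmat \<Rightarrow> infmat"  (infixl \<open>\<star>\<close> 70) where
  "A \<star> B = (\<lambda>i j. Sum_any (\<lambda>k. A i k * B k j))"

definition leading_submat :: "infmat \<Rightarrow> nat \<Rightarrow> int mat" where
  "leading_submat A k = mat k k (\<lambda>(i, j). A i j)"

definition L :: infmat where
  "L i j = (if i < j then 0 else int (((2 * i + 1) choose (i - j)) mod 2))"

definition M :: infmat where
  "M i j = int (((i + j) choose (2 * j)) mod 2)"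

definition D\<^sub>a :: infmat where
  "D\<^sub>a i j = (if i = j then (- 1) ^ i else 0)"

definition unipotent_lower :: "infmat \<Rightarrow> bool" where
  "unipotent_lower A \<longleftrightarrow> (\<forall>i. A i i = 1) \<and> (\<forall>i j. i < j \<longrightarrow> A i j = 0)"

lemma unipotent_lower_L: "unipotent_lower L"
  by (simp add: unipotent_lower_def L_def)

lemma unipotent_lower_M: "unipotent_lower M"
  by (simp add: unipotent_lower_def M_def binomial_eq_0 flip: mult_2)

lemma finite_support_mult_infmat:
  fixes A B :: infmat
  assumes "\<And>k. i < k \<Longrightarrow> A i k = 0"
  shows "finite {k. A i k * B k j \<noteq> 0}"
proof (rule finite_subset)
  show "{k. A i k * B k j \<noteq> 0} \<subseteq> {..i}"
  proof
    fix k assume "k \<in> {k. A i k * B k j \<noteq> 0}"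
    then show "k \<in> {..i}" using assms[of k] by (cases "i < k") auto
  qed
qed simp

end

theory Submission
  imports Defs
begin

text \<open>
  By Lucas' theorem at the prime 2, the parity of \<open>n choose k\<close> is determined by the parity of
  \<open>n div 2 choose k div 2\<close> and the last binary digits of \<open>n\<close> and \<open>k\<close>. Hence each of the two
  matrices is fixed by a substitution that replaces every entry \<open>x\<close> in position \<open>(i, j)\<close> by a
  \<open>2 \<times> 2\<close> block depending only on \<open>x\<close> and on the parity of \<open>i + j\<close>:
  \<open>L\<close> uses \<open>(x 0; x x)\<close> for \<open>i + j\<close> even and \<open>(0 x; x x)\<close> for \<open>i + j\<close> odd, and \<open>M\<close> uses
  \<open>(x 0; x x)\<close> for \<open>i + j\<close> even and \<open>(x x; x 0)\<close> for \<open>i + j\<close> odd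
  (lemmas \<open>L_substitution\<close> and \<open>M_substitution\<close>).

  For the product, split the sum over \<open>k\<close> of \<open>(-1)^k l\<^sub>i\<^sub>k m\<^sub>k\<^sub>j\<close> into even and odd \<open>k\<close>. After the
  substitution rules the sum either cancels termwise or becomes, up to sign, the same sum for the
  halved indices \<open>i div 2\<close> and \<open>j div 2\<close>; the claim follows by induction on \<open>i\<close>.

  For the block decomposition, iterate the substitution \<open>n\<close> times: the \<open>2^n \<times> 2^n\<close> block of \<open>M\<close>
  in block position \<open>(a, b)\<close> depends only on the entry of \<open>M\<close> in position \<open>(a, b)\<close> and on the
  parity of \<open>a + b\<close> (lemma \<open>M_block_cong\<close>). The decomposition of \<open>M(2^(n+2))\<close> is therefore read
  off from the sixteen entries of \<open>M(4)\<close>.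
\<close>

section \<open>Parity of binomial coefficients\<close>

text \<open>
  Modulo 2 one has \<open>(1 + x)^(2 n) = (1 + x^2)^n\<close>; comparing the coefficients gives both
  claims. The induction reproduces this by applying Pascal's rule twice, where the mixed terms
  occur in equal pairs and cancel modulo 2.
\<close>

lemma even_odd_binomial_double:
  "even ((2 * n) choose (Suc (2 * k))) \<and> (odd ((2 * n) choose (2 * k)) \<longleftrightarrow> odd (n choose k))"
proof (induction n arbitrary: k)
  case 0
  show ?case by (cases k) auto
next
  case (Suc n)
  show ?case
  proof (cases k)
    case 0
    then show ?thesis by simp
  next
    case (Suc k')
    then show ?thesis using Suc.IH[of k] Suc.IH[of k'] by auto
  qed
qed

lemma odd_binomial_double [simp]:
  "odd ((2 * n) choose (2 * k)) \<longleftrightarrow> odd (n choose k)"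
  "even ((2 * n) choose (Suc (2 * k)))"
  using even_odd_binomial_double by blast+

lemma odd_binomial_Suc_double [simp]:
  "odd (Suc (2 * n) choose (2 * k)) \<longleftrightarrow> odd (n choose k)"
  "odd (Suc (2 * n) choose (Suc (2 * k))) \<longleftrightarrow> odd (n choose k)"
proof -
  show "odd (Suc (2 * n) choose (2 * k)) \<longleftrightarrow> odd (n choose k)"
    using even_odd_binomial_double[of n k] even_odd_binomial_double[of n "k - 1"]
    by (cases k) auto
  show "odd (Suc (2 * n) choose (Suc (2 * k))) \<longleftrightarrow> odd (n choose k)"
    using even_odd_binomial_double[of n k] by simp
qed

section \<open>The substitution rules of the two matrices\<close>

lemma M_eq_of_bool: "M i j = of_bool (odd ((i + j) choose (2 * j)))"
  by (simp add: M_def mod_2_eq_odd)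

lemma L_eq_of_bool: "L i j = of_bool (j \<le> i \<and> odd (Suc (2 * i) choose (i - j)))"
  by (simp add: L_def mod_2_eq_odd)

lemma M_above_diagonal: "i < j \<Longrightarrow> M i j = 0"
  using unipotent_lower_M by (simp add: unipotent_lower_def)

lemma L_above_diagonal: "i < j \<Longrightarrow> L i j = 0"
  using unipotent_lower_L by (simp add: unipotent_lower_def)

text \<open>
  The last binary digit of \<open>2 j\<close> is 0, so \<open>m\<^sub>i\<^sub>j\<close> is the parity of \<open>(i + j) div 2 choose j\<close>.
  For an odd column index the last binary digits have to be compared a second time, which yields
  the condition on the parity.
\<close>

lemma M_substitution:
  "M (2 * i) (2 * j) = M i j"
  "M (Suc (2 * i)) (2 * j) = M i j"
  "M (2 * i) (Suc (2 * j)) = (if odd (i + j) then M i j else 0)"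
  "M (Suc (2 * i)) (Suc (2 * j)) = (if even (i + j) then M i j else 0)"
proof -
  have half_even: "M i' j' = of_bool (odd (s choose j'))" if "i' + j' = 2 * s" for i' j' s
    unfolding M_eq_of_bool that by simp
  have half_odd: "M i' j' = of_bool (odd (s choose j'))" if "i' + j' = Suc (2 * s)" for i' j' s
    unfolding M_eq_of_bool that by simp
  show "M (2 * i) (2 * j) = M i j"
    by (subst half_even[of _ _ "i + j"]) (simp_all add: M_eq_of_bool)
  show "M (Suc (2 * i)) (2 * j) = M i j"
    by (subst half_odd[of _ _ "i + j"]) (simp_all add: M_eq_of_bool)
  have up: "M (2 * i) (Suc (2 * j)) = of_bool (odd ((i + j) choose (Suc (2 * j))))"
    by (rule half_odd) simp
  have down: "M (Suc (2 * i)) (Suc (2 * j)) = of_bool (odd (Suc (i + j) choose (Suc (2 * j))))"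
    by (rule half_even) simp
  show "M (2 * i) (Suc (2 * j)) = (if odd (i + j) then M i j else 0)"
  proof (cases "even (i + j)")
    case True
    then obtain s where "i + j = 2 * s" by (rule evenE)
    then show ?thesis using True by (simp only: up) simp
  next
    case False
    then obtain s where s: "i + j = Suc (2 * s)" unfolding Suc_eq_plus1 by (rule oddE)
    then show ?thesis using False half_odd[OF s] by (simp only: up) simp
  qed
  show "M (Suc (2 * i)) (Suc (2 * j)) = (if even (i + j) then M i j else 0)"
  proof (cases "even (i + j)")
    case True
    then obtain s where s: "i + j = 2 * s" by (rule evenE)
    then show ?thesis using True half_even[OF s]
      by (simp only: down s odd_binomial_Suc_double) simp
  next
    case False
    then obtain s where s: "i + j = Suc (2 * s)" unfolding Suc_eq_plus1 by (rule oddE)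
    then have "Suc (i + j) = 2 * Suc s" by simp
    then show ?thesis using False
      by (simp only: down odd_binomial_double) simp
  qed
qed

text \<open>
  Since \<open>2 i + 1\<close> is odd, \<open>l\<^sub>i\<^sub>j\<close> is the parity of \<open>i choose (i - j) div 2\<close>. For an
  even row index the last binary digits have to be compared a second time, which yields the
  condition on the parity.
\<close>

lemma L_substitution:
  "L (2 * i) (2 * j) = (if even (i + j) then L i j else 0)"
  "L (2 * i) (Suc (2 * j)) = (if odd (i + j) then L i j else 0)"
  "L (Suc (2 * i)) (2 * j) = L i j"
  "L (Suc (2 * i)) (Suc (2 * j)) = L i j"
proof -
  have "L (2 * i) (2 * j) = (if even (i + j) then L i j else 0) \<and>
    L (2 * i) (Suc (2 * j)) = (if odd (i + j) then L i j else 0) \<and>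
    L (Suc (2 * i)) (2 * j) = L i j \<and> L (Suc (2 * i)) (Suc (2 * j)) = L i j"
  proof (cases "j \<le> i")
    case False
    then show ?thesis by (simp add: L_above_diagonal)
  next
    case True
    then obtain d where i: "i = j + d" using le_Suc_ex by blast
    have half_even: "L i' j' = of_bool (odd (i' choose s))" if "i' = j' + 2 * s" for i' j' s
    proof -
      have "j' \<le> i'" "i' - j' = 2 * s" using that by simp_all
      then show ?thesis by (simp only: L_eq_of_bool odd_binomial_Suc_double simp_thms)
    qed
    have half_odd: "L i' j' = of_bool (odd (i' choose s))" if "i' = j' + Suc (2 * s)" for i' j' s
    proof -
      have "j' \<le> i'" "i' - j' = Suc (2 * s)" using that by simp_all
      then show ?thesis by (simp only: L_eq_of_bool odd_binomial_Suc_double simp_thms)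
    qed
    have ee: "L (2 * i) (2 * j) = of_bool (odd ((2 * i) choose d))"
      by (rule half_even) (simp add: i)
    have oe: "L (Suc (2 * i)) (2 * j) = of_bool (odd (Suc (2 * i) choose d))"
      by (rule half_odd) (simp add: i)
    have oo: "L (Suc (2 * i)) (Suc (2 * j)) = of_bool (odd (Suc (2 * i) choose d))"
      by (rule half_even) (simp add: i)
    have low: "L i j = of_bool (odd (Suc (2 * i) choose d))"
      by (simp add: L_eq_of_bool i del: binomial_Suc_Suc)
    show ?thesis
    proof (cases "even d")
      case True
      then obtain s where s: "d = 2 * s" by (rule evenE)
      have par: "even (i + j)" by (simp add: i s)
      have L_half: "L i j = of_bool (odd (i choose s))"
        by (simp only: low s odd_binomial_Suc_double)
      have eo: "L (2 * i) (Suc (2 * j)) = 0"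
      proof (cases s)
        case 0
        then show ?thesis by (simp add: L_above_diagonal i s)
      next
        case (Suc t)
        have "L (2 * i) (Suc (2 * j)) = of_bool (odd ((2 * i) choose Suc (2 * t)))"
          by (rule half_odd) (simp add: i s Suc)
        then show ?thesis by (simp only: odd_binomial_double) simp
      qed
      have "L (2 * i) (2 * j) = L i j"
        by (simp only: ee s odd_binomial_double L_half)
      then show ?thesis using par eo by (simp only: oe oo low) simp
    next
      case False
      then obtain s where s: "d = Suc (2 * s)" unfolding Suc_eq_plus1 by (rule oddE)
      have par: "odd (i + j)" by (simp add: i s)
      have L_half: "L i j = of_bool (odd (i choose s))"
        by (simp only: low s odd_binomial_Suc_double)
      have "L (2 * i) (Suc (2 * j)) = of_bool (odd ((2 * i) choose (2 * s)))"
        by (rule half_odd) (simp add: i s)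
      then have eo: "L (2 * i) (Suc (2 * j)) = L i j"
        by (simp only: odd_binomial_double L_half)
      have "L (2 * i) (2 * j) = 0"
        by (simp only: ee s odd_binomial_double) simp
      then show ?thesis using par eo by (simp only: oe oo low) simp
    qed
  qed
  then show "L (2 * i) (2 * j) = (if even (i + j) then L i j else 0)"
    "L (2 * i) (Suc (2 * j)) = (if odd (i + j) then L i j else 0)"
    "L (Suc (2 * i)) (2 * j) = L i j" "L (Suc (2 * i)) (Suc (2 * j)) = L i j"
    by blast+
qed

section \<open>The product\<close>

lemma sum_lessThan_double_split:
  fixes f :: "nat \<Rightarrow> 'a::comm_monoid_add"
  shows "(\<Sum>k<2 * N. f k) = (\<Sum>k<N. f (2 * k) + f (Suc (2 * k)))"
  by (induction N) (simp_all add: ac_simps)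

text \<open>
  As \<open>L\<close> is lower triangular, every bound \<open>N > i\<close> gives the same sum, which allows the choice
  \<open>N = 2 i\<close>: the pairs \<open>2 k, 2 k + 1\<close> then run over \<open>k < i\<close>, a range to which the induction
  hypothesis for \<open>i div 2\<close> applies.
\<close>

lemma alternating_sum_L_M:
  "i < N \<Longrightarrow> (\<Sum>k<N. (- 1) ^ k * (L i k * M k j)) = (if i = j then (- 1) ^ i else 0)"
proof (induction i arbitrary: j N rule: less_induct)
  case (less i)
  let ?S = "\<lambda>N i j. \<Sum>k<N. (- 1) ^ k * (L i k * M k j)"
  let ?D = "\<lambda>i j. if i = j then (- 1) ^ i else (0::int)"
  have bound: "?S N i j = ?S N' i j" if "i < N" "i < N'" for N N' :: nat and j
  proof -
    have "?S K i j = ?S (Suc i) i j" if "i < K" for K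
      by (rule sum.mono_neutral_right) (use that in \<open>auto simp: L_above_diagonal\<close>)
    with that show ?thesis by metis
  qed
  show ?case
  proof (cases "i = 0")
    case True
    have "?S N i j = ?S 1 i j" using less.prems True by (intro bound) auto
    also have "\<dots> = ?D i j" using True
      by (cases "j = 0") (simp_all add: M_above_diagonal L_eq_of_bool, simp add: M_eq_of_bool)
    finally show ?thesis .
  next
    case False
    define h g where "h = i div 2" and "g = j div 2"
    have IH: "?S i h g = ?D h g"
      by (rule less.IH) (use False in \<open>simp_all add: h_def\<close>)
    have "?S N i j = ?S (2 * i) i j" using less.prems False by (intro bound) auto
    also have "\<dots> = (\<Sum>k<i. L i (2 * k) * M (2 * k) j - L i (Suc (2 * k)) * M (Suc (2 * k)) j)"
      by (simp add: sum_lessThan_double_split)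
    finally have S: "?S N i j =
      (\<Sum>k<i. L i (2 * k) * M (2 * k) j - L i (Suc (2 * k)) * M (Suc (2 * k)) j)" .
    have term_sign: "?S N i j = c * ?D h g"
      if "\<And>k. L i (2 * k) * M (2 * k) j - L i (Suc (2 * k)) * M (Suc (2 * k)) j
        = c * ((- 1) ^ k * (L h k * M k g))" for c
      unfolding S that sum_distrib_left[symmetric] IH ..
    have i_cases: "i = 2 * h \<or> i = Suc (2 * h)" and j_cases: "j = 2 * g \<or> j = Suc (2 * g)"
      unfolding h_def g_def by presburger+
    show ?thesis
    proof (cases "even i"; cases "even j")
      assume "even i" "even j"
      then have ij: "i = 2 * h" "j = 2 * g" using i_cases j_cases by auto
      have "?S N i j = (- 1) ^ h * ?D h g"
        by (rule term_sign) (auto simp: ij M_substitution L_substitution minus_one_power_iff)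
      then show ?thesis by (simp add: ij flip: power_add mult_2)
    next
      assume "odd i" "even j"
      then have ij: "i = Suc (2 * h)" "j = 2 * g" using i_cases j_cases by auto
      have "?S N i j = 0 * ?D h g"
        by (rule term_sign) (auto simp: ij M_substitution L_substitution)
      moreover have "i \<noteq> j" using \<open>odd i\<close> \<open>even j\<close> by auto
      ultimately show ?thesis by simp
    next
      assume "even i" "odd j"
      then have ij: "i = 2 * h" "j = Suc (2 * g)" using i_cases j_cases by auto
      (* For h + g even both products vanish for every k; for h + g odd exactly one of them
         survives, and then h \<noteq> g, so the halved sum is 0. *)
      have "?S N i j = (if even (h + g) then 0 else (- 1) ^ h) * ?D h g"
        by (rule term_sign) (auto simp: ij M_substitution L_substitution minus_one_power_iff)
      moreover have "i \<noteq> j" using \<open>even i\<close> \<open>odd j\<close> by auto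
      ultimately show ?thesis by auto
    next
      assume "odd i" "odd j"
      then have ij: "i = Suc (2 * h)" "j = Suc (2 * g)" using i_cases j_cases by auto
      have "?S N i j = - ((- 1) ^ g) * ?D h g"
        by (rule term_sign) (auto simp: ij M_substitution L_substitution minus_one_power_iff)
      then show ?thesis by (simp add: ij flip: power_add mult_2)
    qed
  qed
qed

lemma L_mult_D: "(L \<star> D\<^sub>a) i k = (- 1) ^ k * L i k"
proof -
  have "(L \<star> D\<^sub>a) i k = (\<Sum>l\<in>{k}. L i l * D\<^sub>a l k)"
    unfolding mult_infmat_def by (rule Sum_any.expand_superset) (auto simp: D\<^sub>a_def split: if_splits)
  then show ?thesis by (simp add: D\<^sub>a_def)
qed

lemma L_D_M_eq_D: "L \<star> D\<^sub>a \<star> M = D\<^sub>a"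
proof (intro ext)
  fix i j
  have "(L \<star> D\<^sub>a \<star> M) i j = Sum_any (\<lambda>k. (L \<star> D\<^sub>a) i k * M k j)"
    by (simp add: mult_infmat_def)
  also have "\<dots> = (\<Sum>k<Suc i. (L \<star> D\<^sub>a) i k * M k j)"
  proof (rule Sum_any.expand_superset)
    show "{k. (L \<star> D\<^sub>a) i k * M k j \<noteq> 0} \<subseteq> {..<Suc i}"
      by (auto simp: L_mult_D) (metis L_above_diagonal less_Suc_eq_le not_le)
  qed simp
  also have "\<dots> = D\<^sub>a i j"
    using alternating_sum_L_M[of i "Suc i" j] by (simp only: L_mult_D D\<^sub>a_def mult.assoc)
  finally show "(L \<star> D\<^sub>a \<star> M) i j = D\<^sub>a i j" .
qed

section \<open>The block decomposition\<close>

text \<open>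
  Passing from block size \<open>2^n\<close> to \<open>2^(n+1)\<close> applies the substitution once more, and the
  substitution sees only the entry and the parity of the index sum. Block offsets enter that
  parity through \<open>(a + b) 2^n\<close>, so assuming \<open>a + b\<close> and \<open>c + d\<close> of equal parity suffices
  at every stage, including \<open>n = 0\<close>.
\<close>

lemma M_block_cong:
  assumes "M a b = M c d" and "even (a + b) \<longleftrightarrow> even (c + d)"
    and "i < 2 ^ n" and "j < 2 ^ n"
  shows "M (a * 2 ^ n + i) (b * 2 ^ n + j) = M (c * 2 ^ n + i) (d * 2 ^ n + j)"
  using assms(3,4)
proof (induction n arbitrary: i j)
  case 0
  then show ?case using assms(1) by simp
next
  case (Suc n)
  define h g where "h = i div 2" and "g = j div 2"
  have "h < 2 ^ n" "g < 2 ^ n" using Suc.prems by (auto simp: h_def g_def)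
  then have IH: "M (a * 2 ^ n + h) (b * 2 ^ n + g) = M (c * 2 ^ n + h) (d * 2 ^ n + g)"
    by (rule Suc.IH)
  have parity: "even (a * 2 ^ n + h + (b * 2 ^ n + g)) \<longleftrightarrow> even (c * 2 ^ n + h + (d * 2 ^ n + g))"
    using assms(2) by (cases "n = 0") auto
  have double: "x * 2 ^ Suc n + 2 * y = 2 * (x * 2 ^ n + y)"
    "x * 2 ^ Suc n + Suc (2 * y) = Suc (2 * (x * 2 ^ n + y))" for x y :: nat
    by simp_all
  have "i = 2 * h \<or> i = Suc (2 * h)" "j = 2 * g \<or> j = Suc (2 * g)"
    unfolding h_def g_def by presburger+
  then show ?case
    by (elim disjE) (simp_all only: double M_substitution IH parity)
qed

lemma M_small:
  "M 0 0 = 1" "M 1 0 = 1" "M 1 1 = 1" "M 2 0 = 1" "M 2 1 = 1" "M 3 0 = 1" "M 3 1 = 0" "M 0 2 = 0"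
  by code_simp+

lemma M_diagonal_block:
  assumes "i < 2 ^ n" and "j < 2 ^ n"
  shows "M (2 ^ n + i) (2 ^ n + j) = M i j"
  using M_block_cong[of 1 1 0 0 i n j] assms M_small by simp

text \<open>
  The first three block identities come from equal entries 1 of \<open>M(4)\<close> in positions of equal parity.
  The vanishing block \<open>(3, 1)\<close> is compared with the block \<open>(0, 2)\<close>, which lies above the diagonal
  and has the same parity.
\<close>

lemma M_lower_left_blocks:
  assumes "i < 2 ^ n" and "j < 2 ^ n"
  shows "M (2 * 2 ^ n + i) j = M i j"
    and "M (2 * 2 ^ n + i) (2 ^ n + j) = M (2 ^ n + i) j"
    and "M (3 * 2 ^ n + i) j = M (2 ^ n + i) j"
    and "M (3 * 2 ^ n + i) (2 ^ n + j) = 0"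
proof -
  show "M (2 * 2 ^ n + i) j = M i j"
    using M_block_cong[of 2 0 0 0 i n j] assms by (simp add: M_small)
  show "M (2 * 2 ^ n + i) (2 ^ n + j) = M (2 ^ n + i) j"
    using M_block_cong[of 2 1 1 0 i n j] assms M_small by simp
  show "M (3 * 2 ^ n + i) j = M (2 ^ n + i) j"
    using M_block_cong[of 3 0 1 0 i n j] assms M_small by simp
  have "M (3 * 2 ^ n + i) (1 * 2 ^ n + j) = M (0 * 2 ^ n + i) (2 * 2 ^ n + j)"
    by (rule M_block_cong) (use assms M_small in simp_all)
  also have "\<dots> = 0" using assms by (intro M_above_diagonal) simp
  finally show "M (3 * 2 ^ n + i) (2 ^ n + j) = 0" by simp
qed

text \<open>
  This is the block \<open>B'\<close> of the theorem. Every doubled leading submatrix is determined by its half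
  and by this quadrant, so the second decomposition reduces to that of the quadrant at \<open>n + 1\<close>.
\<close>

definition lower_left_quadrant :: "nat \<Rightarrow> int mat" where
  "lower_left_quadrant n = mat (2 ^ n) (2 ^ n) (\<lambda>(i, j). M (2 ^ n + i) j)"

lemma leading_submat_M_double:
  "leading_submat M (2 ^ Suc n) =
    four_block_mat (leading_submat M (2 ^ n)) (0\<^sub>m (2 ^ n) (2 ^ n))
      (lower_left_quadrant n) (leading_submat M (2 ^ n))" (is "?A = ?B")
proof (rule eq_matI)
  fix i j assume "i < dim_row ?B" "j < dim_col ?B"
  then have ij: "i < 2 ^ Suc n" "j < 2 ^ Suc n"
    by (simp_all add: leading_submat_def)
  have "M i j = M (i - 2 ^ n) (j - 2 ^ n)" if "2 ^ n \<le> i" "2 ^ n \<le> j"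
    using M_diagonal_block[of "i - 2 ^ n" n "j - 2 ^ n"] that ij by simp
  then show "?A $$ (i, j) = ?B $$ (i, j)"
    using ij by (auto simp: leading_submat_def lower_left_quadrant_def M_above_diagonal not_less)
qed (simp_all add: leading_submat_def)

lemma lower_left_quadrant_Suc:
  "lower_left_quadrant (Suc n) =
    four_block_mat (leading_submat M (2 ^ n)) (lower_left_quadrant n)
      (lower_left_quadrant n) (0\<^sub>m (2 ^ n) (2 ^ n))" (is "?A = ?B")
proof (rule eq_matI)
  fix i j assume "i < dim_row ?B" "j < dim_col ?B"
  then have ij: "i < 2 ^ Suc n" "j < 2 ^ Suc n"
    by (simp_all add: leading_submat_def lower_left_quadrant_def)
  have row: "i < 2 ^ n \<or> (\<exists>h<2 ^ n. i = 2 ^ n + h)" if "i < 2 ^ Suc n" for i :: nat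
  proof (cases "i < 2 ^ n")
    case False
    then have "i = 2 ^ n + (i - 2 ^ n)" "i - 2 ^ n < 2 ^ n" using that by simp_all
    then show ?thesis by blast
  qed simp
  have three: "2 ^ Suc n + (2 ^ n + h) = 3 * 2 ^ n + h" for h :: nat by simp
  show "?A $$ (i, j) = ?B $$ (i, j)"
    using row[OF ij(1)] row[OF ij(2)] ij
    by (auto simp: leading_submat_def lower_left_quadrant_def M_lower_left_blocks three)
qed (simp_all add: leading_submat_def lower_left_quadrant_def)

theorem theorem1p3:
  shows "L \<star> D\<^sub>a \<star> M = D\<^sub>a \<and>
    (\<forall>n. \<exists>A' \<in> carrier_mat (2 ^ n) (2 ^ n). \<exists>B' \<in> carrier_mat (2 ^ n) (2 ^ n).
      let Z = 0\<^sub>m (2 ^ n) (2 ^ n) in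
        leading_submat M (2 ^ (n + 1)) = four_block_mat A' Z
                                                        B' A' \<and>
        leading_submat M (2 ^ (n + 2)) =
          four_block_mat
            (four_block_mat A' Z
                            B' A')   (four_block_mat Z Z
                                                     Z Z)
            (four_block_mat A' B'
                            B' Z)    (four_block_mat A' Z
                                                     B' A'))"
proof (intro conjI allI)
  show "L \<star> D\<^sub>a \<star> M = D\<^sub>a" by (rule L_D_M_eq_D)
next
  fix n :: nat
  let ?A = "leading_submat M (2 ^ n)" and ?B = "lower_left_quadrant n"
  let ?Z = "0\<^sub>m (2 ^ n) (2 ^ n) :: int mat"
  have carrier: "?A \<in> carrier_mat (2 ^ n) (2 ^ n)" "?B \<in> carrier_mat (2 ^ n) (2 ^ n)"
    by (simp_all add: leading_submat_def lower_left_quadrant_def)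
  have zero: "0\<^sub>m (2 ^ Suc n) (2 ^ Suc n) = four_block_mat ?Z ?Z ?Z ?Z"
    by (rule eq_matI) auto
  have "leading_submat M (2 ^ (n + 2)) =
      four_block_mat (four_block_mat ?A ?Z ?B ?A) (four_block_mat ?Z ?Z ?Z ?Z)
        (four_block_mat ?A ?B ?B ?Z) (four_block_mat ?A ?Z ?B ?A)"
    using leading_submat_M_double[of "Suc n"]
    by (simp only: leading_submat_M_double[of n] lower_left_quadrant_Suc zero
        add_2_eq_Suc')
  then show "\<exists>A' \<in> carrier_mat (2 ^ n) (2 ^ n). \<exists>B' \<in> carrier_mat (2 ^ n) (2 ^ n).
      let Z = 0\<^sub>m (2 ^ n) (2 ^ n) in
        leading_submat M (2 ^ (n + 1)) = four_block_mat A' Z B' A' \<and>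
        leading_submat M (2 ^ (n + 2)) =
          four_block_mat (four_block_mat A' Z B' A') (four_block_mat Z Z Z Z)
            (four_block_mat A' B' B' Z) (four_block_mat A' Z B' A')"
    using carrier leading_submat_M_double[of n]
    unfolding Let_def Suc_eq_plus1 by blast
qed

end
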